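(* For every integer $n \geq 3$, $$R^{cl}(\omega+n,3) \;\geq\; \omega^2 \cdot n + \omega \cdot (R(n,3)-n)+n .$$
   Context: All arithmetic is ordinal arithmetic. For a set $X$ and $k\in\omega$, $[X]^k=\{Y\subseteq X: |Y|=k\}$. Given ordinals $\beta,\gamma$ and $X\subseteq\gamma$, $X$ is order-homeomorphic to $\beta$ if there is an order-isomorphism $f:X\to\beta$ which is also a homeomorphism, where $\beta$ carries the order topology and $X$ carries the subspace topology inherited from the order topology of $\gamma$. For ordinals $\alpha,\beta,\gamma$, write $\gamma\rightarrow(\alpha,\beta)^2$ if for every function $\mathfrak{c}:[\gamma]^2\to\{0,1\}$ there is $X\subseteq\gamma$ such that either $[X]^2\subseteq\mathfrak{c}^{-1}(0)$ and $X$ is order-homeomorphic to $\alpha$, or $[X]^2\subseteq\mathfrak{c}^{-1}(1)$ and $X$ is order-homeomorphic to $\beta$. The closed Ramsey number $R^{cl}(\alpha,\beta)$ is the least ordinal $\gamma$ with $\gamma\rightarrow(\alpha,\beta)^2$, should such an ordinal exist. $R(m,3)$ denotes the classical Ramsey number: the least $N\in\mathbb{N}$ such that every $\{0,1\}$-coloring of the pairs of an $N$-element set has an $m$-element set all of whose pairs have color $0$ or a $3$-element set all of whose pairs have color $1$. *)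

theory Defs
  imports "HOL-Analysis.Abstract_Topology" "HOL-Library.Ramsey"
begin

unbundle cardinal_syntax

text \<open>
  An ordinal is represented by a well-order relation, as in the HOL library: \<^prop>\<open>Well_order r\<close>
  says that \<^term>\<open>r\<close> is a (reflexive) well-order of \<^term>\<open>Field r\<close>; ordinals are equal up to \<^term>\<open>(=o)\<close>
  and compared by \<^term>\<open>(\<le>o)\<close>. In particular \<^term>\<open>natLeq\<close> is \<open>\<omega>\<close> and \<^term>\<open>natLeq_on n\<close> is
  the finite ordinal \<^term>\<open>n\<close>.
\<close>

subsection \<open>Ordinal arithmetic\<close>

definition ord_plus :: "'a rel \<Rightarrow> 'b rel \<Rightarrow> ('a + 'b) rel"  (infixl \<open>+\<^sub>O\<close> 65) where
  "r +\<^sub>O s = {(Inl a, Inl a') | a a'. (a, a') \<in> r} \<union> {(Inr b, Inr b') | b b'. (b, b') \<in> s}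
            \<union> {(Inl a, Inr b) | a b. a \<in> Field r \<and> b \<in> Field s}"

text \<open>Usual convention \<open>\<omega> \<cdot> 2 = \<omega> + \<omega>\<close>: the second coordinate is the more significant one.\<close>

definition ord_times :: "'a rel \<Rightarrow> 'b rel \<Rightarrow> ('a \<times> 'b) rel"  (infixl \<open>*\<^sub>O\<close> 70) where
  "r *\<^sub>O s = {((a, b), (a', b')) | a b a' b'.
      a \<in> Field r \<and> a' \<in> Field r \<and> (b, b') \<in> s \<and> (b = b' \<longrightarrow> (a, a') \<in> r)}"

subsection \<open>The order topology and order-homeomorphism\<close>

text \<open>The open rays form a subbase; \<^term>\<open>Field r\<close> is only needed if it has at most one element.\<close>

definition order_topology :: "'a rel \<Rightarrow> 'a topology" where
  "order_topology r =
     topology_generated_by (insert (Field r) (underS r ` Field r \<union> aboveS r ` Field r))"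

definition order_homeomorphic :: "'a rel \<Rightarrow> 'a set \<Rightarrow> 'b rel \<Rightarrow> bool" where
  "order_homeomorphic \<gamma> X \<beta> \<longleftrightarrow> X \<subseteq> Field \<gamma> \<and>
     (\<exists>f. iso (Restr \<gamma> X) \<beta> f \<and>
          homeomorphic_map (subtopology (order_topology \<gamma>) X) (order_topology \<beta>) f)"

subsection \<open>Closed Ramsey numbers\<close>

definition closed_arrow :: "'a rel \<Rightarrow> 'b rel \<Rightarrow> 'c rel \<Rightarrow> bool" where
  "closed_arrow \<gamma> \<alpha> \<beta> \<longleftrightarrow>
     (\<forall>c \<in> nsets (Field \<gamma>) 2 \<rightarrow> {0, 1::nat}. \<exists>X \<subseteq> Field \<gamma>.
        (nsets X 2 \<subseteq> c -` {0} \<and> order_homeomorphic \<gamma> X \<alpha>) \<or>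
        (nsets X 2 \<subseteq> c -` {1} \<and> order_homeomorphic \<gamma> X \<beta>))"

text \<open>
  \<^term>\<open>\<gamma>\<close> is the least ordinal with \<open>\<gamma> \<rightarrow> (\<alpha>, \<beta>)\<^sup>2\<close>. Comparing only with well-orders on the
  same type loses nothing, since every smaller ordinal is an initial segment of \<^term>\<open>\<gamma>\<close>;
  see \<open>closed_ramsey_number_le\<close> below. Such a \<^term>\<open>\<gamma>\<close> exists as soon as some ordinal has the
  arrow property (\<open>closed_ramsey_number_exists\<close>).
\<close>

definition is_closed_ramsey_number :: "'a rel \<Rightarrow> 'b rel \<Rightarrow> 'c rel \<Rightarrow> bool" where
  "is_closed_ramsey_number \<gamma> \<alpha> \<beta> \<longleftrightarrow> Well_order \<gamma> \<and> closed_arrow \<gamma> \<alpha> \<beta> \<and>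
     (\<forall>\<delta>::'a rel. Well_order \<delta> \<and> closed_arrow \<delta> \<alpha> \<beta> \<longrightarrow> \<gamma> \<le>o \<delta>)"

subsection \<open>Classical Ramsey numbers\<close>

definition ramsey_number :: "nat \<Rightarrow> nat \<Rightarrow> nat" where
  "ramsey_number m k = (LEAST N. partn_lst {..<N} [m, k] 2)"

subsection \<open>Basic facts\<close>

lemma Field_ord_plus: "Field (r +\<^sub>O s) = Inl ` Field r \<union> Inr ` Field s"
proof
  show "Field (r +\<^sub>O s) \<subseteq> Inl ` Field r \<union> Inr ` Field s"
    by (auto simp: ord_plus_def Field_def)
  have "Inl a \<in> Field (r +\<^sub>O s) \<and> Inl b \<in> Field (r +\<^sub>O s)" if "(a, b) \<in> r" for a b
    using that by (intro conjI FieldI1[of _ "Inl b"] FieldI2[of "Inl a"]) (simp_all add: ord_plus_def)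
  moreover have "Inr a \<in> Field (r +\<^sub>O s) \<and> Inr b \<in> Field (r +\<^sub>O s)" if "(a, b) \<in> s" for a b
    using that by (intro conjI FieldI1[of _ "Inr b"] FieldI2[of "Inr a"]) (simp_all add: ord_plus_def)
  ultimately show "Inl ` Field r \<union> Inr ` Field s \<subseteq> Field (r +\<^sub>O s)"
    by (auto simp: Field_def[of r] Field_def[of s])
qed

lemma Field_ord_times:
  assumes "Refl r" "Refl s"
  shows "Field (r *\<^sub>O s) = Field r \<times> Field s"
proof
  show "Field (r *\<^sub>O s) \<subseteq> Field r \<times> Field s"
    unfolding ord_times_def by (auto simp: Field_def)
  show "Field r \<times> Field s \<subseteq> Field (r *\<^sub>O s)"
  proof safe
    fix a b assume "a \<in> Field r" "b \<in> Field s"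
    then have "((a, b), (a, b)) \<in> r *\<^sub>O s"
      using assms by (simp add: ord_times_def refl_on_def)
    then show "(a, b) \<in> Field (r *\<^sub>O s)"
      by (rule FieldI1)
  qed
qed

lemma Well_orderI:
  assumes "Refl r" "trans r" "antisym r" "Total r"
    and "\<And>A. A \<subseteq> Field r \<Longrightarrow> A \<noteq> {} \<Longrightarrow> \<exists>a\<in>A. \<forall>b\<in>A. (a, b) \<in> r"
  shows "Well_order r"
proof -
  have "Linear_order r"
    using assms unfolding linear_order_on_def partial_order_on_def preorder_on_def
    by (auto simp: Field_def)
  then show ?thesis
    using assms(5) by (simp add: Linear_order_Well_order_iff)
qed

lemma Well_order_minimum:
  assumes "Well_order r" "A \<subseteq> Field r" "A \<noteq> {}"
  shows "\<exists>a\<in>A. \<forall>b\<in>A. (a, b) \<in> r"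
proof -
  have "Linear_order r"
    using assms(1) by (simp add: well_order_on_def)
  then show ?thesis
    using assms Linear_order_Well_order_iff by blast
qed

lemma Well_order_props:
  assumes "Well_order r"
  shows "Refl r" "trans r" "antisym r" "Total r"
  using assms
  by (auto simp: well_order_on_def linear_order_on_def partial_order_on_def preorder_on_def)

lemma Well_order_ord_plus:
  assumes r: "Well_order r" and s: "Well_order s"
  shows "Well_order (r +\<^sub>O s)"
proof (rule Well_orderI)
  note R = Well_order_props[OF r] and S = Well_order_props[OF s]
  show "Refl (r +\<^sub>O s)"
    using R(1) S(1) unfolding refl_on_def Field_ord_plus by (auto simp: ord_plus_def)
  show "trans (r +\<^sub>O s)"
  proof (rule transI)
    fix x y z assume "(x, y) \<in> r +\<^sub>O s" "(y, z) \<in> r +\<^sub>O s"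
    then show "(x, z) \<in> r +\<^sub>O s"
      using R(2) S(2) unfolding ord_plus_def by (auto dest: transD intro: FieldI1 FieldI2)
  qed
  show "antisym (r +\<^sub>O s)"
    using R(3) S(3) unfolding antisym_def by (auto simp: ord_plus_def)
  show "Total (r +\<^sub>O s)"
  proof (rule total_onI)
    fix x y assume xy: "x \<in> Field (r +\<^sub>O s)" "y \<in> Field (r +\<^sub>O s)" "x \<noteq> y"
    have "(a, b) \<in> r \<or> (b, a) \<in> r" if "a \<in> Field r" "b \<in> Field r" "a \<noteq> b" for a b
      using R(4) that by (auto simp: total_on_def)
    moreover have "(a, b) \<in> s \<or> (b, a) \<in> s" if "a \<in> Field s" "b \<in> Field s" "a \<noteq> b" for a b
      using S(4) that by (auto simp: total_on_def)
    ultimately show "(x, y) \<in> r +\<^sub>O s \<or> (y, x) \<in> r +\<^sub>O s"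
      using xy unfolding Field_ord_plus by (elim UnE imageE) (simp_all add: ord_plus_def)
  qed
  fix A assume A: "A \<subseteq> Field (r +\<^sub>O s)" "A \<noteq> {}"
  show "\<exists>a\<in>A. \<forall>b\<in>A. (a, b) \<in> r +\<^sub>O s"
  proof (cases "Inl -` A = {}")
    case False
    moreover have "Inl -` A \<subseteq> Field r"
      using A by (auto simp: Field_ord_plus)
    ultimately obtain a where a: "Inl a \<in> A" "a \<in> Field r" "\<And>b. Inl b \<in> A \<Longrightarrow> (a, b) \<in> r"
      using Well_order_minimum[OF r, of "Inl -` A"] by auto
    have "(Inl a, p) \<in> r +\<^sub>O s" if "p \<in> A" for p
      using that A(1)[unfolded Field_ord_plus] a by (cases p) (auto simp: ord_plus_def)
    then show ?thesis
      using a(1) by blast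
  next
    case True
    obtain p where "p \<in> A"
      using A(2) by blast
    with True have "Inr -` A \<noteq> {}"
      by (cases p) auto
    moreover have "Inr -` A \<subseteq> Field s"
      using A by (auto simp: Field_ord_plus)
    ultimately obtain a where a: "Inr a \<in> A" "\<And>b. Inr b \<in> A \<Longrightarrow> (a, b) \<in> s"
      using Well_order_minimum[OF s, of "Inr -` A"] by auto
    have "(Inr a, p) \<in> r +\<^sub>O s" if "p \<in> A" for p
      using that True a by (cases p) (auto simp: ord_plus_def)
    then show ?thesis
      using a(1) by blast
  qed
qed

lemma Well_order_ord_times:
  assumes r: "Well_order r" and s: "Well_order s"
  shows "Well_order (r *\<^sub>O s)"
proof (rule Well_orderI)
  note R = Well_order_props[OF r] and S = Well_order_props[OF s]
  note F = Field_ord_times[OF R(1) S(1)]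
  show "Refl (r *\<^sub>O s)"
    using R(1) S(1) unfolding refl_on_def F by (auto simp: ord_times_def)
  show "trans (r *\<^sub>O s)"
  proof (rule transI)
    fix x y z assume "(x, y) \<in> r *\<^sub>O s" "(y, z) \<in> r *\<^sub>O s"
    then show "(x, z) \<in> r *\<^sub>O s"
      using R(2) S(2,3) unfolding ord_times_def by (auto dest: transD antisymD)
  qed
  show "antisym (r *\<^sub>O s)"
    using R(3) S(3) unfolding antisym_def by (auto simp: ord_times_def)
  show "Total (r *\<^sub>O s)"
  proof (rule total_onI)
    fix x y assume "x \<in> Field (r *\<^sub>O s)" "y \<in> Field (r *\<^sub>O s)" "x \<noteq> y"
    then obtain a b a' b' where xy: "x = (a, b)" "y = (a', b')"
        "a \<in> Field r" "a' \<in> Field r" "b \<in> Field s" "b' \<in> Field s" "a \<noteq> a' \<or> b \<noteq> b'"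
      unfolding F by auto
    moreover have "(b, b') \<in> s \<or> (b', b) \<in> s" "(a, a') \<in> r \<or> (a', a) \<in> r" "(b, b) \<in> s"
      using R(1,4) S(1,4) xy(3-6) unfolding total_on_def refl_on_def by metis+
    ultimately show "(x, y) \<in> r *\<^sub>O s \<or> (y, x) \<in> r *\<^sub>O s"
      by (auto simp: ord_times_def)
  qed
  fix A assume A: "A \<subseteq> Field (r *\<^sub>O s)" "A \<noteq> {}"
  then have "snd ` A \<subseteq> Field s" "snd ` A \<noteq> {}"
    by (auto simp: F)
  then obtain b where b: "b \<in> snd ` A" "\<forall>b'\<in>snd ` A. (b, b') \<in> s"
    using Well_order_minimum[OF s] by metis
  have "{a. (a, b) \<in> A} \<subseteq> Field r" "{a. (a, b) \<in> A} \<noteq> {}"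
    using A b by (auto simp: F)
  then obtain a where a: "(a, b) \<in> A" "\<forall>a'. (a', b) \<in> A \<longrightarrow> (a, a') \<in> r"
    using Well_order_minimum[OF r] by (metis mem_Collect_eq)
  show "\<exists>a\<in>A. \<forall>b\<in>A. (a, b) \<in> r *\<^sub>O s"
  proof (intro bexI[OF _ a(1)] ballI)
    fix p assume p: "p \<in> A"
    obtain a' b' where "p = (a', b')" by fastforce
    then show "((a, b), p) \<in> r *\<^sub>O s"
      using p A(1) a b unfolding F by (force simp: ord_times_def)
  qed
qed

lemma topspace_order_topology [simp]: "topspace (order_topology r) = Field r"
  by (auto simp: order_topology_def underS_def aboveS_def Field_def)

lemma openin_underS: "a \<in> Field r \<Longrightarrow> openin (order_topology r) (underS r a)"
  unfolding order_topology_def by (rule topology_generated_by_Basis) auto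

lemma openin_aboveS: "a \<in> Field r \<Longrightarrow> openin (order_topology r) (aboveS r a)"
  unfolding order_topology_def by (rule topology_generated_by_Basis) auto

lemma iso_continuous:
  assumes "iso r s f"
  shows "continuous_map (order_topology r) (order_topology s) f"
proof -
  have f: "bij_betw f (Field r) (Field s)"
    and le: "\<And>a b. a \<in> Field r \<Longrightarrow> b \<in> Field r \<Longrightarrow> (a, b) \<in> r \<longleftrightarrow> (f a, f b) \<in> s"
    using assms by (auto simp: iso_iff2)
  have eq: "f a = f b \<longleftrightarrow> a = b" if "a \<in> Field r" "b \<in> Field r" for a b
    using f that by (auto simp: bij_betw_def inj_on_def)
  have u: "f -` underS s (f a) \<inter> Field r = underS r a" if "a \<in> Field r" for a
    using le[OF _ that] eq[OF _ that] by (fastforce simp: underS_def dest: FieldI1)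
  have v: "f -` aboveS s (f a) \<inter> Field r = aboveS r a" if "a \<in> Field r" for a
    using le[OF that] eq[OF _ that] by (fastforce simp: aboveS_def dest: FieldI2)
  have im: "f ` Field r = Field s"
    using f by (simp add: bij_betw_def)
  show ?thesis
    unfolding order_topology_def[of s]
  proof (rule continuous_on_generated_topo)
    fix U assume "U \<in> insert (Field s) (underS s ` Field s \<union> aboveS s ` Field s)"
    then consider "U = Field s" | a where "a \<in> Field r" "U = underS s (f a)"
      | a where "a \<in> Field r" "U = aboveS s (f a)"
      unfolding im[symmetric] by auto
    then show "openin (order_topology r) (f -` U \<inter> topspace (order_topology r))"
    proof cases
      case 1
      then have "f -` U \<inter> topspace (order_topology r) = topspace (order_topology r)"
        using im by auto
      then show ?thesis
        by (metis openin_topspace)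
    qed (simp_all add: u v openin_underS openin_aboveS)
  qed (use im in auto)
qed

lemma iso_homeomorphic_map:
  assumes "iso r s f"
  shows "homeomorphic_map (order_topology r) (order_topology s) f"
proof -
  have f: "bij_betw f (Field r) (Field s)"
    using assms by (simp add: iso_iff2)
  let ?g = "inv_into (Field r) f"
  have "iso s r ?g"
    unfolding iso_iff2
  proof (intro conjI ballI)
    show "bij_betw ?g (Field s) (Field r)"
      using f by (rule bij_betw_inv_into)
    fix a b assume ab: "a \<in> Field s" "b \<in> Field s"
    then have "?g a \<in> Field r" "?g b \<in> Field r" "f (?g a) = a" "f (?g b) = b"
      using f by (simp_all add: bij_betw_def inv_into_into f_inv_into_f)
    then show "(a, b) \<in> s \<longleftrightarrow> (?g a, ?g b) \<in> r"
      using assms unfolding iso_iff2 by metis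
  qed
  then have "homeomorphic_maps (order_topology r) (order_topology s) f ?g"
    using iso_continuous[OF assms] iso_continuous[of s r ?g] f
    by (simp add: homeomorphic_maps_def bij_betw_inv_into_left bij_betw_inv_into_right)
  then show ?thesis
    using homeomorphic_map_maps by blast
qed

lemma order_homeomorphic_iso:
  assumes refl: "Refl r" "Refl s" and g: "iso r s g" and X: "order_homeomorphic s (g ` X) \<beta>" "X \<subseteq> Field r"
  shows "order_homeomorphic r X \<beta>"
proof -
  obtain f where f: "iso (Restr s (g ` X)) \<beta> f"
      "homeomorphic_map (subtopology (order_topology s) (g ` X)) (order_topology \<beta>) f"
    using X by (auto simp: order_homeomorphic_def)
  have inj: "inj_on g (Field r)" and im: "g ` Field r = Field s"
    and le: "\<And>a b. a \<in> Field r \<Longrightarrow> b \<in> Field r \<Longrightarrow> (a, b) \<in> r \<longleftrightarrow> (g a, g b) \<in> s"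
    using g by (auto simp: iso_iff2 bij_betw_def)
  have gX: "g ` X \<subseteq> Field s"
    using im X by blast
  have Fr: "Field (Restr r X) = X" and Fs: "Field (Restr s (g ` X)) = g ` X"
    using Refl_Field_Restr2 refl X(2) gX by blast+
  have "iso (Restr r X) (Restr s (g ` X)) g"
    unfolding iso_iff2 Fr Fs using inj X(2) le
    by (auto simp: bij_betw_def intro: inj_on_subset)
  then have 1: "iso (Restr r X) \<beta> (f \<circ> g)"
    using f(1) bij_betw_trans[of g X "g ` X" f "Field \<beta>"] unfolding iso_iff2 Fr Fs by simp
  have "homeomorphic_map (subtopology (order_topology r) X) (subtopology (order_topology s) (g ` X)) g"
    using iso_homeomorphic_map[OF g] X(2) gX
    by (intro homeomorphic_map_subtopologies) (auto simp: Int_absorb1)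
  then have "homeomorphic_map (subtopology (order_topology r) X) (order_topology \<beta>) (f \<circ> g)"
    using f(2) homeomorphic_map_compose by blast
  with 1 X show ?thesis
    by (auto simp: order_homeomorphic_def)
qed

lemma closed_arrow_ordIso:
  assumes "r =o s" "closed_arrow s \<alpha> \<beta>"
  shows "closed_arrow r \<alpha> \<beta>"
  unfolding closed_arrow_def
proof
  fix c assume c: "c \<in> nsets (Field r) 2 \<rightarrow> {0, 1::nat}"
  obtain g where W: "Well_order r" "Well_order s" and g: "iso r s g"
    using assms(1) by (auto simp: ordIso_def)
  have refl: "Refl r" "Refl s"
    by (rule Well_order_props(1)[OF W(1)] Well_order_props(1)[OF W(2)])+
  have inj: "inj_on g (Field r)" and im: "g ` Field r = Field s"
    using g by (auto simp: iso_iff2 bij_betw_def)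
  let ?h = "inv_into (Field r) g"
  have h: "inj_on ?h (Field s)" "?h ` Field s = Field r"
    using inj im bij_betw_inv_into[of g "Field r" "Field s"] by (simp_all add: bij_betw_def)
  have "(\<lambda>e. c (?h ` e)) \<in> nsets (Field s) 2 \<rightarrow> {0, 1::nat}"
  proof
    fix e assume "e \<in> nsets (Field s) 2"
    then have "?h ` e \<in> nsets (Field r) 2"
      using h by (auto simp: nsets_def card_image inj_on_subset)
    then show "c (?h ` e) \<in> {0, 1}"
      using c by blast
  qed
  then obtain Y where Y: "Y \<subseteq> Field s"
      "(nsets Y 2 \<subseteq> (\<lambda>e. c (?h ` e)) -` {0} \<and> order_homeomorphic s Y \<alpha>) \<or>
       (nsets Y 2 \<subseteq> (\<lambda>e. c (?h ` e)) -` {1} \<and> order_homeomorphic s Y \<beta>)"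
    using assms(2) unfolding closed_arrow_def by meson
  define X where "X = ?h ` Y"
  have X: "X \<subseteq> Field r" "g ` X = Y"
    using Y(1) h im by (auto simp: X_def image_image f_inv_into_f subset_iff)
  have "c e = c (?h ` (g ` e)) \<and> g ` e \<in> nsets Y 2" if "e \<in> nsets X 2" for e
  proof -
    have e: "e \<subseteq> Field r" "e \<subseteq> X"
      using that X by (auto simp: nsets_def)
    then have "?h ` (g ` e) = e"
      using inj by (simp add: inv_into_image_cancel)
    moreover have "g ` e \<in> nsets Y 2"
      using that e X inj by (auto simp: nsets_def card_image inj_on_subset)
    ultimately show ?thesis
      by simp
  qed
  then have "(nsets X 2 \<subseteq> c -` {0} \<and> order_homeomorphic r X \<alpha>) \<or>
       (nsets X 2 \<subseteq> c -` {1} \<and> order_homeomorphic r X \<beta>)"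
    using Y(2) order_homeomorphic_iso[OF refl g, of X \<alpha>] order_homeomorphic_iso[OF refl g, of X \<beta>] X
    by (auto simp: subset_iff)
  then show "\<exists>X \<subseteq> Field r. (nsets X 2 \<subseteq> c -` {0} \<and> order_homeomorphic r X \<alpha>) \<or>
        (nsets X 2 \<subseteq> c -` {1} \<and> order_homeomorphic r X \<beta>)"
    using X(1) by blast
qed

lemma closed_ramsey_number_le:
  fixes \<gamma> :: "'a rel" and \<delta> :: "'d rel"
  assumes "is_closed_ramsey_number \<gamma> \<alpha> \<beta>" "Well_order \<delta>" "closed_arrow \<delta> \<alpha> \<beta>"
  shows "\<gamma> \<le>o \<delta>"
proof (rule ccontr)
  assume "\<not> \<gamma> \<le>o \<delta>"
  moreover have W: "Well_order \<gamma>"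
    using assms by (simp add: is_closed_ramsey_number_def)
  ultimately have less: "\<delta> <o \<gamma>"
    using assms(2) not_ordLeq_iff_ordLess by blast
  then obtain a where a: "\<delta> =o Restr \<gamma> (underS \<gamma> a)"
    using ordLess_iff_ordIso_Restr[OF W assms(2)] by blast
  then have "closed_arrow (Restr \<gamma> (underS \<gamma> a)) \<alpha> \<beta>"
    using closed_arrow_ordIso ordIso_symmetric assms(3) by blast
  moreover have "Well_order (Restr \<gamma> (underS \<gamma> a))"
    using a by (auto simp: ordIso_def)
  ultimately have "\<gamma> \<le>o Restr \<gamma> (underS \<gamma> a)"
    using assms(1) by (simp add: is_closed_ramsey_number_def)
  then show False
    using a less ordIso_symmetric ordLeq_ordIso_trans not_ordLess_ordLeq by blast
qed

lemma closed_ramsey_number_exists: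
  fixes \<gamma> :: "'a rel"
  assumes "Well_order \<gamma>" "closed_arrow \<gamma> \<alpha> \<beta>"
  shows "\<exists>\<rho>::'a rel. is_closed_ramsey_number \<rho> \<alpha> \<beta>"
proof -
  let ?R = "{\<delta>::'a rel. Well_order \<delta> \<and> closed_arrow \<delta> \<alpha> \<beta>}"
  have "?R \<noteq> {}" "\<forall>\<delta>\<in>?R. Well_order \<delta>"
    using assms by auto
  then obtain \<rho> where "\<rho> \<in> ?R" "\<forall>\<delta>\<in>?R. \<rho> \<le>o \<delta>"
    using exists_minim_Well_order[of ?R] by blast
  then show ?thesis
    by (auto simp: is_closed_ramsey_number_def)
qed

lemma partn_lst_ramsey_number: "partn_lst {..<ramsey_number m k} [m, k] 2"
  unfolding ramsey_number_def by (rule LeastI_ex) (rule ramsey_full)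

text \<open>Hence the natural-number subtraction \<^term>\<open>ramsey_number m k - m\<close> does not truncate.\<close>

lemma le_ramsey_number:
  assumes "2 \<le> k"
  shows "m \<le> ramsey_number m k"
proof -
  let ?N = "ramsey_number m k"
  have "(\<lambda>_. 0) \<in> nsets {..<?N} 2 \<rightarrow> {..<length [m, k]}"
    by simp
  then obtain i where i: "i < length [m, k]" "monochromatic {..<?N} ([m, k] ! i) 2 (\<lambda>_. 0) i"
    using partn_lst_ramsey_number[of m k] unfolding partn_lst_def by blast
  then obtain H where H: "H \<in> nsets {..<?N} ([m, k] ! i)" "(\<lambda>_. 0) ` nsets H 2 \<subseteq> {i}"
    by (auto simp: monochromatic_def)
  have "i = 0"
  proof (rule ccontr)
    assume "i \<noteq> 0"
    with i have "i = 1"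
      by simp
    with H have H1: "card H = k" "nsets H 2 = {}"
      by (auto simp: nsets_def)
    then obtain T where "T \<subseteq> H" "card T = 2" "finite T"
      using assms obtain_subset_with_card_n[of 2 H] by metis
    with H1 show False
      by (auto simp: nsets_def)
  qed
  then have "H \<subseteq> {..<?N}" "card H = m"
    using H by (auto simp: nsets_def)
  then show ?thesis
    by (metis card_lessThan card_mono finite_lessThan)
qed

end

theory Submission
  imports Defs
begin

text \<open>
  Let \<open>R\<close> be the classical Ramsey number of \<open>n\<close> and \<open>3\<close>, and let \<open>m = R - n\<close>. Every ordinal \<open>\<gamma>\<close>
  below \<open>\<omega>\<^sup>2 \<cdot> n + \<omega> \<cdot> m + n\<close> carries a triangle-free graph without an independent closed copy of
  \<open>\<omega> + n\<close>; colouring its edges \<open>1\<close> and its non-edges \<open>0\<close> shows that \<open>\<gamma>\<close> does not have the arrow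
  property. Since \<open>\<gamma>\<close> is a proper initial segment, it has at most \<open>n - 2\<close> points after
  \<open>\<omega>\<^sup>2 \<cdot> n + \<omega> \<cdot> m\<close>.

  A closed copy of \<open>\<omega> + n\<close> contains a limit point \<open>x\<close> of itself followed by \<open>n - 1\<close> further points
  (\<open>closed_omega_plus_limit_point\<close>), so it is enough to make sure that these cannot all be
  independent. The points are divided as follows, where \<open>i < n\<close> and \<open>j < m\<close>:
    \<^item> leaves, the successor ordinals of the \<open>i\<close>-th block \<open>[\<omega>\<^sup>2 \<cdot> i, \<omega>\<^sup>2 \<cdot> (i + 1))\<close> (and \<open>0\<close>);
    \<^item> hubs, the limits \<open>\<omega>\<^sup>2 \<cdot> i + \<omega> \<cdot> (q + 1)\<close> inside the \<open>i\<close>-th block;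
    \<^item> cores, the \<open>R - 1\<close> points \<open>\<omega>\<^sup>2 \<cdot> (i + 1)\<close> and \<open>\<omega>\<^sup>2 \<cdot> n + \<omega> \<cdot> j\<close> (which agree for \<open>i = n - 1\<close>, \<open>j = 0\<close>),
      listed in increasing order as \<open>c\<^sub>0 < c\<^sub>1 < \<dots>\<close>, so that for \<open>i < n\<close> the core \<open>c\<^sub>i\<close> is the
      supremum of the \<open>i\<close>-th block;
    \<^item> tail points, all the others: the successors above \<open>\<omega>\<^sup>2 \<cdot> n\<close>, and \<open>\<omega>\<^sup>2 \<cdot> n + \<omega> \<cdot> m\<close>.

  The cores carry a Ramsey-critical graph \<open>E\<close>: triangle-free, without independent \<open>n\<close>-sets. Three
  kinds of edges keep limits from being approached independently: a hub is joined to the leaves in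
  the \<open>\<omega>\<close>-interval just below it, the core \<open>c\<^sub>i\<close> with \<open>i < n\<close> to all hubs of its block, and the
  later cores to the tail points in the \<open>\<omega>\<close>-interval just below them. The limit
  \<open>\<omega>\<^sup>2 \<cdot> n + \<omega> \<cdot> m\<close> has too few points after it. Hence \<open>x = c\<^sub>i\<close> for some \<open>i < n\<close>, approached by
  leaves of its block (\<open>independent_limit_cases\<close>). These leaves are joined to all later hubs and to
  all tail points, and \<open>c\<^sub>i\<close> is joined to all later leaves. So the \<open>n - 1\<close> points after \<open>c\<^sub>i\<close> are
  cores and form, together with \<open>c\<^sub>i\<close>, an independent \<open>n\<close>-set of \<open>E\<close>, a contradiction
  (\<open>no_independent_closed_copy\<close>).

  The one danger to triangle-freeness (\<open>adj_triangle_free\<close>) is that two cores \<open>c\<^sub>u\<close>, \<open>c\<^sub>v\<close> with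
  \<open>u, v < n - 1\<close> have common neighbours among the leaves. It is averted by numbering the vertices of
  \<open>E\<close> so that \<open>{..<n - 1}\<close> is independent, which is possible because \<open>E\<close> is as large as possible
  (\<open>ramsey_graph_with_independent_initial_segment\<close>).
\<close>

section \<open>Ramsey-critical graphs\<close>

text \<open>
  The vertices \<open>a\<close>, \<open>b\<close>, \<open>c\<close> of a triangle may coincide, so \<open>E\<close> has no loops.
\<close>

definition ramsey_graph :: "nat \<Rightarrow> nat \<Rightarrow> (nat \<Rightarrow> nat \<Rightarrow> bool) \<Rightarrow> bool" where
  "ramsey_graph n N E \<longleftrightarrow> symp E \<and> (\<forall>a b c. \<not> (E a b \<and> E b c \<and> E a c)) \<and>
     (\<forall>S\<subseteq>{..<N}. card S = n \<longrightarrow> (\<exists>u\<in>S. \<exists>v\<in>S. E u v))"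

lemma ramsey_graph_sym: "ramsey_graph n N E \<Longrightarrow> E u v \<longleftrightarrow> E v u"
  unfolding ramsey_graph_def symp_def by blast

lemma ramsey_graph_triangle_free: "ramsey_graph n N E \<Longrightarrow> \<not> (E a b \<and> E b c \<and> E a c)"
  unfolding ramsey_graph_def by blast

lemma less_ramsey_number_if_ramsey_graph:
  assumes "ramsey_graph n N E"
  shows "N < ramsey_number n 3"
proof (rule ccontr)
  assume "\<not> N < ramsey_number n 3"
  then have part: "partn_lst {..<N} [n, 3] 2"
    using partn_lst_greater_resource[OF partn_lst_ramsey_number] by simp
  note sym = ramsey_graph_sym[OF assms] and tri = ramsey_graph_triangle_free[OF assms]
  define f where "f e = (if \<exists>u v. e = {u, v} \<and> E u v then 1 else 0::nat)" for e
  have f: "f {u, v} = (if E u v then 1 else 0)" for u v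
    using sym unfolding f_def doubleton_eq_iff by metis
  have "f \<in> nsets {..<N} 2 \<rightarrow> {..<2}"
    by (simp add: f_def)
  then obtain i H where i: "i < length [n, 3]" "H \<in> nsets {..<N} ([n, 3] ! i)" "f ` nsets H 2 \<subseteq> {i}"
    by (rule partn_lstE[OF part]) simp
  have col: "f {u, v} = i" if "u \<in> H" "v \<in> H" "u \<noteq> v" for u v
    using i(3) that by (auto simp: image_subset_iff)
  consider "i = 0" | "i = 1"
    using i(1) by fastforce
  then show False
  proof cases
    case 1
    then have "H \<subseteq> {..<N}" "card H = n"
      using i(2) by (auto simp: nsets_def)
    then obtain u v where uv: "u \<in> H" "v \<in> H" "E u v"
      using assms unfolding ramsey_graph_def by blast
    then have "u \<noteq> v"
      using tri by blast
    then show False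
      using col[of u v] f[of u v] uv 1 by simp
  next
    case 2
    then have "card H = 3"
      using i(2) by (simp add: nsets_def)
    then obtain a b c where H: "H = {a, b, c}" "a \<noteq> b" "b \<noteq> c" "a \<noteq> c"
      unfolding card_3_iff by blast
    have "E u v" if "u \<in> H" "v \<in> H" "u \<noteq> v" for u v
    proof (rule ccontr)
      assume "\<not> E u v"
      then have "f {u, v} = 0"
        by (simp add: f)
      then show False
        using col[OF that] 2 by simp
    qed
    then show False
      using tri[of a b c] H by simp
  qed
qed

lemma ramsey_graph_if_less_ramsey_number:
  assumes "N < ramsey_number n 3"
  obtains E where "ramsey_graph n N E"
proof -
  have "\<not> partn_lst {..<N} [n, 3] 2"
    using assms not_less_Least unfolding ramsey_number_def by blast
  then obtain f where f: "f \<in> nsets {..<N} 2 \<rightarrow> {..<length [n, 3]}"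
      and no: "\<And>i. i < length [n, 3] \<Longrightarrow> \<not> monochromatic {..<N} ([n, 3] ! i) 2 f i"
    unfolding partn_lst_def by blast
  define E where "E u v \<longleftrightarrow> u < N \<and> v < N \<and> u \<noteq> v \<and> f {u, v} = 1" for u v
  have "\<not> (E a b \<and> E b c \<and> E a c)" for a b c
  proof
    assume "E a b \<and> E b c \<and> E a c"
    then have "{a, b, c} \<in> nsets {..<N} 3" "f {a, b} = 1" "f {b, c} = 1" "f {a, c} = 1"
      by (auto simp: E_def nsets_def)
    moreover from this have "f {b, a} = 1" "f {c, b} = 1" "f {c, a} = 1"
      by (metis insert_commute)+
    ultimately have "f ` nsets {a, b, c} 2 \<subseteq> {1}"
      by (auto elim!: nsets2_E)
    then show False
      using no[of 1] \<open>{a, b, c} \<in> nsets {..<N} 3\<close> by (auto simp: monochromatic_def)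
  qed
  moreover have "\<exists>u\<in>S. \<exists>v\<in>S. E u v" if S: "S \<subseteq> {..<N}" "card S = n" for S
  proof -
    have "S \<in> nsets {..<N} n"
      using S finite_subset by (auto simp: nsets_def)
    then have "\<not> f ` nsets S 2 \<subseteq> {0}"
      using no[of 0] by (auto simp: monochromatic_def)
    then obtain e where e: "e \<in> nsets S 2" "f e \<noteq> 0"
      by blast
    obtain u v where uv: "e = {u, v}" "u \<in> S" "v \<in> S" "u \<noteq> v"
      using e(1) by (rule nsets2_E)
    have "e \<in> nsets {..<N} 2"
      using uv S(1) by auto
    then have "f e \<in> {..<length [n, 3]}"
      using f by (rule funcset_mem[rotated])
    then have "f {u, v} = 1"
      using e(2) uv(1) by auto
    then have "E u v"
      using uv S(1) by (auto simp: E_def)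
    then show ?thesis
      using uv by blast
  qed
  moreover have "symp E"
    by (auto simp: E_def symp_def insert_commute)
  ultimately have "ramsey_graph n N E"
    unfolding ramsey_graph_def by blast
  then show ?thesis
    by (rule that)
qed

text \<open>
  A largest graph of this kind has an independent set of size \<open>n - 1\<close>: otherwise adding an isolated
  vertex would give a larger one. Renumbering the vertices moves this set to the front.
\<close>

lemma ramsey_graph_with_independent_initial_segment:
  assumes "0 < n"
  obtains E where "ramsey_graph n (ramsey_number n 3 - 1) E"
    "\<And>u v. u < n - 1 \<Longrightarrow> v < n - 1 \<Longrightarrow> \<not> E u v"
proof -
  obtain N where R: "ramsey_number n 3 = Suc N"
    using assms le_ramsey_number[of 3 n] by (cases "ramsey_number n 3") auto
  then have "N < ramsey_number n 3"
    by simp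
  then obtain E where E: "ramsey_graph n N E"
    by (rule ramsey_graph_if_less_ramsey_number)
  note sym = ramsey_graph_sym[OF E] and tri = ramsey_graph_triangle_free[OF E]
  have "\<exists>I\<subseteq>{..<N}. card I = n - 1 \<and> (\<forall>u\<in>I. \<forall>v\<in>I. \<not> E u v)"
  proof (rule ccontr)
    assume no: "\<not> ?thesis"
    \<comment> \<open>\<open>E\<close> may have edges at \<open>N\<close>; the restriction makes \<open>N\<close> the new isolated vertex.\<close>
    define E' where "E' u v \<longleftrightarrow> u < N \<and> v < N \<and> E u v" for u v
    have "\<exists>u\<in>S. \<exists>v\<in>S. E' u v" if S: "S \<subseteq> {..<Suc N}" "card S = n" for S
    proof -
      have fin: "finite S"
        using S(1) finite_subset by blast
      have "n - 1 \<le> card (S - {N})"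
        using S fin by (simp add: card_Diff_singleton_if)
      then obtain I where I: "I \<subseteq> S - {N}" "card I = n - 1"
        using obtain_subset_with_card_n by metis
      then have sub: "I \<subseteq> {..<N}"
        using S(1) unfolding lessThan_Suc by blast
      then obtain u v where "u \<in> I" "v \<in> I" "E u v"
        using no I(2) by blast
      then have "u \<in> S" "v \<in> S" "E' u v"
        using sub I(1) by (auto simp: E'_def)
      then show ?thesis
        by blast
    qed
    moreover have "symp E'"
      by (rule sympI) (use sym in \<open>auto simp: E'_def\<close>)
    moreover have "\<not> (E' a b \<and> E' b c \<and> E' a c)" for a b c
      using tri[of a b c] by (auto simp: E'_def)
    ultimately have "ramsey_graph n (Suc N) E'"
      unfolding ramsey_graph_def by blast
    then have "Suc N < ramsey_number n 3"
      by (rule less_ramsey_number_if_ramsey_graph)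
    then show False
      using R by simp
  qed
  then obtain I where I: "I \<subseteq> {..<N}" "card I = n - 1" "\<And>u v. u \<in> I \<Longrightarrow> v \<in> I \<Longrightarrow> \<not> E u v"
    by blast
  have le: "n - 1 \<le> N"
    using I card_mono[of "{..<N}" I] by simp
  have finI: "finite I"
    using I(1) finite_subset by blast
  obtain g where g: "bij_betw g {..<n - 1} I"
    using finite_same_card_bij[of "{..<n - 1}" I] finI I(2) by auto
  obtain h where h: "bij_betw h {n - 1..<N} ({..<N} - I)"
    using finite_same_card_bij[of "{n - 1..<N}" "{..<N} - I"] I finI by (auto simp: card_Diff_subset)
  define p where "p u = (if u < n - 1 then g u else h u)" for u
  have p1: "bij_betw p {..<n - 1} I"
    using g by (rule bij_betw_cong[THEN iffD1, rotated]) (simp add: p_def)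
  have p2: "bij_betw p {n - 1..<N} ({..<N} - I)"
    using h by (rule bij_betw_cong[THEN iffD1, rotated]) (simp add: p_def)
  have "bij_betw p ({..<n - 1} \<union> {n - 1..<N}) (I \<union> ({..<N} - I))"
    by (rule bij_betw_combine[OF p1 p2]) blast
  moreover have "{..<n - 1} \<union> {n - 1..<N} = {..<N}" "I \<union> ({..<N} - I) = {..<N}"
    using le I(1) by auto
  ultimately have p: "bij_betw p {..<N} {..<N}"
    by simp
  have "\<exists>u\<in>S. \<exists>v\<in>S. E (p u) (p v)" if S: "S \<subseteq> {..<N}" "card S = n" for S
  proof -
    have "p ` S \<subseteq> {..<N}" "card (p ` S) = n"
      using p S by (auto simp: bij_betw_def card_image inj_on_subset)
    then have "\<exists>u\<in>p ` S. \<exists>v\<in>p ` S. E u v"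
      using E unfolding ramsey_graph_def by blast
    then show ?thesis
      by blast
  qed
  moreover have "symp (\<lambda>u v. E (p u) (p v))"
    by (rule sympI) (use sym in blast)
  ultimately have "ramsey_graph n N (\<lambda>u v. E (p u) (p v))"
    using tri by (simp add: ramsey_graph_def)
  then have "ramsey_graph n (ramsey_number n 3 - 1) (\<lambda>u v. E (p u) (p v))"
    by (simp add: R)
  moreover have "\<not> E (p u) (p v)" if "u < n - 1" "v < n - 1" for u v
    using I(3) bij_betwE[OF p1] that by blast
  ultimately show ?thesis
    using that[of "\<lambda>u v. E (p u) (p v)"] by blast
qed

section \<open>Membership in sums and products of well-orders\<close>

lemma natLeq_iff: "(a, b) \<in> natLeq \<longleftrightarrow> a \<le> b"
  by (simp add: natLeq_def)

lemma ord_plus_iff: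
  "(Inl a, Inl a') \<in> r +\<^sub>O s \<longleftrightarrow> (a, a') \<in> r"
  "(Inl a, Inr b) \<in> r +\<^sub>O s \<longleftrightarrow> a \<in> Field r \<and> b \<in> Field s"
  "(Inr b, Inl a) \<notin> r +\<^sub>O s"
  "(Inr b, Inr b') \<in> r +\<^sub>O s \<longleftrightarrow> (b, b') \<in> s"
  by (auto simp: ord_plus_def)

lemma ord_times_iff:
  "((a, b), (a', b')) \<in> r *\<^sub>O s \<longleftrightarrow>
     a \<in> Field r \<and> a' \<in> Field r \<and> (b, b') \<in> s \<and> (b = b' \<longrightarrow> (a, a') \<in> r)"
  by (auto simp: ord_times_def)

section \<open>The limit point of a closed copy of \<open>\<omega> + n\<close>\<close>

text \<open>
  The least point \<open>b\<close> of the second summand is the supremum of the copy of \<open>\<omega>\<close>: a ray around \<open>b\<close> that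
  points down contains the whole copy, one that points up starts inside it. Final segments, unlike
  single points of the copy, survive the finite intersections in generating the topology.
\<close>

lemma Inl_eventually_in_openin:
  assumes "openin (order_topology (natLeq +\<^sub>O s)) U" "Inr b \<in> U" "\<And>c. c \<in> Field s \<Longrightarrow> (b, c) \<in> s"
    and "antisym s"
  shows "\<exists>k. \<forall>l\<ge>k. Inl l \<in> U"
proof -
  let ?B = "insert (Field (natLeq +\<^sub>O s))
    (underS (natLeq +\<^sub>O s) ` Field (natLeq +\<^sub>O s) \<union> aboveS (natLeq +\<^sub>O s) ` Field (natLeq +\<^sub>O s))"
  have "generate_topology_on ?B U"
    using assms(1) unfolding order_topology_def by (rule openin_topology_generated_by)
  then show ?thesis
    using assms(2)
  proof induction
    case (Int U V)
    then obtain k k' where "\<forall>l\<ge>k. Inl l \<in> U" "\<forall>l\<ge>k'. Inl l \<in> V"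
      by blast
    then show ?case
      by (intro exI[of _ "max k k'"]) auto
  next
    case (Basis U)
    then consider "U = Field (natLeq +\<^sub>O s)"
      | a where "a \<in> Field (natLeq +\<^sub>O s)" "U = underS (natLeq +\<^sub>O s) a"
      | a where "a \<in> Field (natLeq +\<^sub>O s)" "U = aboveS (natLeq +\<^sub>O s) a"
      by blast
    then show ?case
    proof cases
      case 1
      then show ?thesis
        by (auto simp: Field_ord_plus Field_natLeq)
    next
      case (2 a)
      then obtain c where c: "a = Inr c" "(b, c) \<in> s"
        using Basis.prems by (cases a) (auto simp: underS_def ord_plus_iff)
      then have "Inl l \<in> U" for l
        using 2(2) by (auto simp: underS_def ord_plus_iff Field_natLeq intro: FieldI2)
      then show ?thesis
        by blast
    next
      case (3 a)
      show ?thesis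
      proof (cases a)
        case (Inl k)
        then have "Inl l \<in> U" if "l \<ge> Suc k" for l
          using 3 that by (auto simp: aboveS_def ord_plus_iff natLeq_iff)
        then show ?thesis
          by blast
      next
        case (Inr c)
        then have "c \<in> Field s" "(c, b) \<in> s" "c \<noteq> b"
          using 3 Basis.prems by (auto simp: aboveS_def ord_plus_iff intro: FieldI1)
        then show ?thesis
          using assms(3,4) by (auto dest: antisymD)
      qed
    qed
  qed blast+
qed

text \<open>
  All that is used of a closed copy of \<open>\<omega> + n\<close>: the point \<open>x\<close> corresponding to \<open>\<omega>\<close> is, in the order
  topology of the ambient ordinal and not merely within \<open>X\<close>, a limit of smaller points of \<open>X\<close>.
  Openness of the homeomorphism turns a ray above \<open>y < x\<close> into a neighbourhood of \<open>\<omega>\<close>.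
\<close>

lemma closed_omega_plus_limit_point:
  assumes hom: "order_homeomorphic \<gamma> X (natLeq +\<^sub>O natLeq_on n)" and n: "0 < n" and \<gamma>: "Well_order \<gamma>"
  obtains x Z where "x \<in> X" "\<exists>s\<in>X. s \<in> underS \<gamma> x"
    "\<And>y. y \<in> underS \<gamma> x \<Longrightarrow> \<exists>s\<in>X. s \<in> aboveS \<gamma> y \<and> s \<in> underS \<gamma> x"
    "Z \<subseteq> X" "Z \<subseteq> aboveS \<gamma> x" "card Z = n - 1"
proof -
  let ?W = "natLeq +\<^sub>O natLeq_on n"
  obtain f where X: "X \<subseteq> Field \<gamma>" and iso: "iso (Restr \<gamma> X) ?W f"
      and homeo: "homeomorphic_map (subtopology (order_topology \<gamma>) X) (order_topology ?W) f"
    using hom by (auto simp: order_homeomorphic_def)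
  have "Field (Restr \<gamma> X) = X"
    using Refl_Field_Restr2[OF Well_order_props(1)[OF \<gamma>] X] .
  then have bij: "bij_betw f X (Field ?W)"
      and le: "\<And>a b. a \<in> X \<Longrightarrow> b \<in> X \<Longrightarrow> (a, b) \<in> \<gamma> \<longleftrightarrow> (f a, f b) \<in> ?W"
    using iso by (auto simp: iso_iff2)
  have surj: "\<exists>a\<in>X. f a = w" if "w \<in> Field ?W" for w
    using bij that unfolding bij_betw_def by (metis imageE)
  have FW: "Inl k \<in> Field ?W" "Inr l \<in> Field ?W \<longleftrightarrow> l < n" for k l
    by (auto simp: Field_ord_plus Field_natLeq Field_natLeq_on)
  have W: "(Inl k, Inr 0) \<in> ?W" for k
    using n by (auto simp: ord_plus_def Field_natLeq Field_natLeq_on)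
  obtain x where x: "x \<in> X" "f x = Inr 0"
    using surj FW(2)[of 0] n by blast
  have below: "s \<in> underS \<gamma> x" if "s \<in> X" "f s = Inl k" for s k
    using le[OF that(1) x(1)] that W x by (auto simp: underS_def)
  obtain s where s: "s \<in> X" "f s = Inl 0"
    using surj FW(1)[of 0] by blast
  have approach: "\<exists>s\<in>X. s \<in> aboveS \<gamma> y \<and> s \<in> underS \<gamma> x" if y: "y \<in> underS \<gamma> x" for y
  proof -
    let ?U = "aboveS \<gamma> y \<inter> X"
    have "openin (subtopology (order_topology \<gamma>) X) ?U"
      using y openin_aboveS[of y \<gamma>] by (auto simp: openin_subtopology underS_def Field_def)
    then have "openin (order_topology ?W) (f ` ?U)"
      using homeo homeomorphic_imp_open_map open_map_def by blast
    moreover have "Inr 0 \<in> f ` ?U"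
      using x y by (force simp: aboveS_def underS_def)
    moreover have "antisym (natLeq_on n)"
      by (auto simp: antisym_def)
    ultimately have "\<exists>k. \<forall>l\<ge>k. Inl l \<in> f ` ?U"
      using n by (intro Inl_eventually_in_openin[of "natLeq_on n" "f ` ?U" 0]) (auto simp: Field_natLeq_on)
    then obtain k where "Inl k \<in> f ` ?U"
      by blast
    then obtain s where "Inl k = f s" "s \<in> ?U"
      by (rule imageE)
    then show ?thesis
      using below[of s k] by auto
  qed
  define Z where "Z = {z \<in> X. \<exists>l. f z = Inr l \<and> 0 < l}"
  have "f ` Z = Inr ` {1..<n}"
  proof
    show "f ` Z \<subseteq> Inr ` {1..<n}"
      using bij FW(2) by (force simp: Z_def bij_betw_def)
    show "Inr ` {1..<n} \<subseteq> f ` Z"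
    proof
      fix w :: "nat + nat" assume "w \<in> Inr ` {1..<n}"
      then obtain l where l: "w = Inr l" "0 < l" "l < n"
        by auto
      then obtain z where z: "z \<in> X" "f z = w"
        using surj FW(2) by blast
      then have "z \<in> Z"
        using l by (auto simp: Z_def)
      then show "w \<in> f ` Z"
        using z(2) by blast
    qed
  qed
  moreover have "inj_on f Z"
    using bij by (auto simp: bij_betw_def Z_def intro: inj_on_subset)
  ultimately have "card Z = n - 1"
    using card_image[of f Z] by (simp add: card_image)
  moreover have "Z \<subseteq> aboveS \<gamma> x"
  proof
    fix z assume z: "z \<in> Z"
    then obtain l where l: "z \<in> X" "f z = Inr l" "0 < l"
      by (auto simp: Z_def)
    then have "l < n"
      using bij FW(2) by (force simp: bij_betw_def)
    then have "(f x, f z) \<in> ?W"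
      using l x by (auto simp: ord_plus_def)
    then show "z \<in> aboveS \<gamma> x"
      using le[OF x(1) l(1)] l x by (auto simp: aboveS_def)
  qed
  moreover have "\<exists>s\<in>X. s \<in> underS \<gamma> x"
    using below s by blast
  moreover have "Z \<subseteq> X"
    by (simp add: Z_def)
  ultimately show ?thesis
    using that[of x Z] x(1) approach by blast
qed

section \<open>The graph\<close>

text \<open>
  The ordinal is mapped to a graph on labels, and two points are joined when their labels are.
  \<open>Leaf i q\<close> lies in the \<open>q\<close>-th \<open>\<omega>\<close>-interval of the \<open>i\<close>-th block, whose supremum is
  \<open>Hub i q\<close>; \<open>Tail j\<close> lies in the \<open>j\<close>-th \<open>\<omega>\<close>-interval above \<open>\<omega>\<^sup>2 \<cdot> n\<close>, whose supremum is
  \<open>Core (n + j)\<close> unless it is the last one.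
\<close>

datatype vertex = Leaf nat nat | Hub nat nat | Core nat | Tail nat

fun arc :: "nat \<Rightarrow> (nat \<Rightarrow> nat \<Rightarrow> bool) \<Rightarrow> vertex \<Rightarrow> vertex \<Rightarrow> bool" where
  "arc n E (Leaf i q) (Hub k q') \<longleftrightarrow> i < k \<or> (i = k \<and> q = q')"
| "arc n E (Leaf k q) (Core v) \<longleftrightarrow> v < k \<and> k < n"
| "arc n E (Leaf i q) (Tail j) \<longleftrightarrow> True"
| "arc n E (Hub k q) (Core v) \<longleftrightarrow> v = k"
| "arc n E (Core v) (Tail j) \<longleftrightarrow> v = n + j"
| "arc n E (Core u) (Core v) \<longleftrightarrow> E u v"
| "arc n E _ _ \<longleftrightarrow> False"

definition adj :: "nat \<Rightarrow> (nat \<Rightarrow> nat \<Rightarrow> bool) \<Rightarrow> vertex \<Rightarrow> vertex \<Rightarrow> bool" where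
  "adj n E x y \<longleftrightarrow> arc n E x y \<or> arc n E y x"

text \<open>
  Leaves, hubs and tail points are three independent classes. The neighbours of a hub are leaves and
  one core \<open>k\<close>, and a leaf joined to both would have block index at most \<open>k\<close> and greater than \<open>k\<close>.
  A tail point is joined to leaves and to one core \<open>n + j\<close>, which has no neighbours among the
  leaves. Two cores joined to the same leaf are below \<open>n - 1\<close>, hence not joined to each other.
\<close>

lemma adj_triangle_free:
  assumes E: "ramsey_graph n N E" and indep: "\<And>u v. u < n - 1 \<Longrightarrow> v < n - 1 \<Longrightarrow> \<not> E u v"
  shows "\<not> (adj n E x y \<and> adj n E y z \<and> adj n E x z)"
proof -
  note sym = ramsey_graph_sym[OF E] and tri = ramsey_graph_triangle_free[OF E]
  have irrefl: "\<not> E a a" for a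
    using tri[of a a a] by simp
  show ?thesis
    unfolding adj_def
    by (cases x; cases y; cases z) (auto simp: sym tri irrefl indep)
qed

text \<open>
  In the arguments, \<open>((p, q), i)\<close> is the ordinal \<open>\<omega>\<^sup>2 \<cdot> i + \<omega> \<cdot> q + p\<close>, the pair \<open>(p, j)\<close> is
  \<open>\<omega>\<^sup>2 \<cdot> n + \<omega> \<cdot> j + p\<close>, and \<open>Inr l\<close> is \<open>\<omega>\<^sup>2 \<cdot> n + \<omega> \<cdot> m + l\<close>. The tail index of \<open>Inr l\<close> is arbitrary:
  these points have to be joined to all leaves, and more edges do no harm. The point \<open>0\<close> is not a
  limit and counts as a leaf.
\<close>

fun label :: "nat \<Rightarrow> ((nat \<times> nat) \<times> nat + nat \<times> nat) + nat \<Rightarrow> vertex" where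
  "label n (Inl (Inl ((Suc p, q), i))) = Leaf i q"
| "label n (Inl (Inl ((0, Suc q), i))) = Hub i q"
| "label n (Inl (Inl ((0, 0), Suc i))) = Core i"
| "label n (Inl (Inl ((0, 0), 0))) = Leaf 0 0"
| "label n (Inl (Inr (Suc p, j))) = Tail j"
| "label n (Inl (Inr (0, j))) = Core (n - 1 + j)"
| "label n (Inr l) = Tail 0"

section \<open>Coordinates in \<open>\<omega>\<^sup>2 \<cdot> n + \<omega> \<cdot> m + n\<close>\<close>

abbreviation bound :: "nat \<Rightarrow> nat \<Rightarrow> (((nat \<times> nat) \<times> nat + nat \<times> nat) + nat) rel" where
  "bound n m \<equiv> (natLeq *\<^sub>O natLeq) *\<^sub>O natLeq_on n +\<^sub>O natLeq *\<^sub>O natLeq_on m +\<^sub>O natLeq_on n"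

lemma Well_order_bound: "Well_order (bound n m)"
  by (intro Well_order_ord_plus Well_order_ord_times natLeq_Well_order natLeq_on_Well_order)

lemma Field_bound_parts:
  "Field (natLeq *\<^sub>O natLeq) = UNIV"
  "Field ((natLeq *\<^sub>O natLeq) *\<^sub>O natLeq_on n) = UNIV \<times> {..<n}"
  "Field (natLeq *\<^sub>O natLeq_on n) = UNIV \<times> {..<n}"
proof -
  note refl = Well_order_props(1)
  show square: "Field (natLeq *\<^sub>O natLeq) = UNIV"
    by (subst Field_ord_times[OF refl[OF natLeq_Well_order] refl[OF natLeq_Well_order]])
      (auto simp: Field_natLeq)
  show "Field ((natLeq *\<^sub>O natLeq) *\<^sub>O natLeq_on n) = UNIV \<times> {..<n}"
    by (subst Field_ord_times[OF refl[OF Well_order_ord_times[OF natLeq_Well_order natLeq_Well_order]]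
          refl[OF natLeq_on_Well_order]])
      (auto simp: square Field_natLeq_on)
  show "Field (natLeq *\<^sub>O natLeq_on n) = UNIV \<times> {..<n}"
    by (subst Field_ord_times[OF refl[OF natLeq_Well_order] refl[OF natLeq_on_Well_order]])
      (auto simp: Field_natLeq Field_natLeq_on)
qed

lemma Field_bound_iff:
  "Inl (Inl (a, i)) \<in> Field (bound n m) \<longleftrightarrow> i < n"
  "Inl (Inr (p, j)) \<in> Field (bound n m) \<longleftrightarrow> j < m"
  "Inr l \<in> Field (bound n m) \<longleftrightarrow> l < n"
  by (auto simp: Field_ord_plus Field_bound_parts Field_natLeq_on)

lemma bound_iff:
  "(Inl (Inl ((p, q), i)), Inl (Inl ((p', q'), i'))) \<in> bound n m \<longleftrightarrow>
     i < n \<and> i' < n \<and> (i < i' \<or> i = i' \<and> (q < q' \<or> q = q' \<and> p \<le> p'))"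
  "(Inl (Inl (a, i)), Inl (Inr (p, j))) \<in> bound n m \<longleftrightarrow> i < n \<and> j < m"
  "(Inl (Inr (p, j)), Inl (Inl (a, i))) \<notin> bound n m"
  "(Inl (Inr (p, j)), Inl (Inr (p', j'))) \<in> bound n m \<longleftrightarrow> j < m \<and> j' < m \<and> (j < j' \<or> j = j' \<and> p \<le> p')"
  "(Inl (Inl (a, i)), Inr l) \<in> bound n m \<longleftrightarrow> i < n \<and> l < n"
  "(Inl (Inr (p, j)), Inr l) \<in> bound n m \<longleftrightarrow> j < m \<and> l < n"
  "(Inr l, Inl b) \<notin> bound n m"
  "(Inr l, Inr l') \<in> bound n m \<longleftrightarrow> l < n \<and> l' < n \<and> l \<le> l'"
  by (auto simp: ord_plus_iff ord_times_iff Field_ord_plus Field_bound_parts Field_natLeq Field_natLeq_on natLeq_iff)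

section \<open>Closed copies of \<open>\<omega> + n\<close> are not independent\<close>

lemma label_eq_Core_less:
  assumes "0 < n" "a \<in> Field (bound n m)" "label n a = Core v"
  shows "v < n + m - 1"
  using assms by (cases "(n, a)" rule: label.cases) (auto simp: Field_bound_iff)

lemma label_eq_Core_inj:
  assumes "a \<in> Field (bound n m)" "b \<in> Field (bound n m)" "label n a = Core v" "label n b = Core v"
  shows "a = b"
  using assms by (cases "(n, a)" rule: label.cases; cases "(n, b)" rule: label.cases)
    (auto simp: Field_bound_iff)

lemma label_above_Core:
  assumes "(x, z) \<in> bound n m" "label n x = Core i" "i < n"
  shows "label n z = Leaf k q \<Longrightarrow> i < k \<and> k < n" "label n z = Hub k q \<Longrightarrow> i < k"
  using assms by (cases "(n, x)" rule: label.cases; cases "(n, z)" rule: label.cases;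
    auto simp: bound_iff)+

text \<open>
  The point \<open>0\<close> is ruled out by \<open>below\<close>; otherwise \<open>approach\<close> is applied to one well-chosen point \<open>y\<close>
  below \<open>x\<close>. If \<open>x\<close> is a successor,
  its predecessor leaves no room for a point between. If \<open>x\<close> is a hub or a core, then \<open>y\<close> is the start
  of the \<open>\<omega>\<close>-interval or of the block below \<open>x\<close>, which forces a label on the point between; that
  label is joined to the label of \<open>x\<close> unless \<open>x\<close> tops a block and the point is a leaf of that block.
\<close>

lemma independent_limit_cases:
  assumes n: "0 < n" and x: "x \<in> X" "x \<in> Field (bound n m)"
    and indep: "\<And>a b. a \<in> X \<Longrightarrow> b \<in> X \<Longrightarrow> a \<noteq> b \<Longrightarrow> \<not> adj n E (label n a) (label n b)"
    and below: "\<exists>s\<in>X. s \<in> underS (bound n m) x"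
    and approach: "\<And>y. y \<in> underS (bound n m) x \<Longrightarrow>
      \<exists>s\<in>X. s \<in> aboveS (bound n m) y \<and> s \<in> underS (bound n m) x"
  obtains l where "x = Inr l"
  | i q s where "i < n" "label n x = Core i" "s \<in> X" "s \<in> underS (bound n m) x" "label n s = Leaf i q"
proof -
  have between: "\<exists>s\<in>X. (y, s) \<in> bound n m \<and> y \<noteq> s \<and> (s, x) \<in> bound n m \<and> s \<noteq> x"
    if "(y, x) \<in> bound n m" "y \<noteq> x" for y
    using approach[of y] that by (auto simp: underS_def aboveS_def)
  have nonadj: "\<not> adj n E (label n s) (label n x)" if "s \<in> X" "s \<noteq> x" for s
    using indep that x(1) by blast
  show thesis
  proof (cases "(n, x)" rule: label.cases)
    case (1 n' p q i)
    then obtain s where "(Inl (Inl ((p, q), i)), s) \<in> bound n m" "Inl (Inl ((p, q), i)) \<noteq> s"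
        "(s, x) \<in> bound n m" "s \<noteq> x"
      using between[of "Inl (Inl ((p, q), i))"] x(2) by (auto simp: bound_iff Field_bound_iff)
    then show thesis
      using 1 by (cases "(n, s)" rule: label.cases) (auto simp: bound_iff)
  next
    case (2 n' q i)
    then obtain s where s: "s \<in> X" "(Inl (Inl ((0, q), i)), s) \<in> bound n m" "Inl (Inl ((0, q), i)) \<noteq> s"
        "(s, x) \<in> bound n m" "s \<noteq> x"
      using between[of "Inl (Inl ((0, q), i))"] x(2) by (auto simp: bound_iff Field_bound_iff)
    then have "adj n E (label n s) (label n x)"
      using 2 by (cases "(n, s)" rule: label.cases) (auto simp: bound_iff adj_def)
    then show thesis
      using nonadj s by blast
  next
    case (3 n' i)
    then obtain s where s: "s \<in> X" "(Inl (Inl ((0, 0), i)), s) \<in> bound n m" "Inl (Inl ((0, 0), i)) \<noteq> s"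
        "(s, x) \<in> bound n m" "s \<noteq> x"
      using between[of "Inl (Inl ((0, 0), i))"] x(2) by (auto simp: bound_iff Field_bound_iff)
    then have "(\<exists>q. label n s = Leaf i q) \<or> (\<exists>q. label n s = Hub i q)"
      using 3 by (cases "(n, s)" rule: label.cases) (auto simp: bound_iff)
    moreover have "label n x = Core i" "i < n"
      using 3 x(2) by (auto simp: Field_bound_iff)
    ultimately show thesis
      using nonadj[of s] s that(2) by (auto simp: adj_def underS_def)
  next
    case (4 n')
    obtain s where "(s, x) \<in> bound n m" "s \<noteq> x"
      using below by (auto simp: underS_def)
    then show thesis
      using 4 by (cases "(n, s)" rule: label.cases) (auto simp: bound_iff)
  next
    case (5 n' p j)
    then obtain s where "(Inl (Inr (p, j)), s) \<in> bound n m" "Inl (Inr (p, j)) \<noteq> s"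
        "(s, x) \<in> bound n m" "s \<noteq> x"
      using between[of "Inl (Inr (p, j))"] x(2) by (auto simp: bound_iff Field_bound_iff)
    then show thesis
      using 5 by (cases "(n, s)" rule: label.cases) (auto simp: bound_iff)
  next
    case (6 n' j)
    show thesis
    proof (cases j)
      case 0
      obtain s where s: "s \<in> X" "(Inl (Inl ((0, 0), n - 1)), s) \<in> bound n m"
          "Inl (Inl ((0, 0), n - 1)) \<noteq> s" "(s, x) \<in> bound n m" "s \<noteq> x"
        using between[of "Inl (Inl ((0, 0), n - 1))"] n x(2) 6 0 by (auto simp: bound_iff Field_bound_iff)
      then have "(\<exists>q. label n s = Leaf (n - 1) q) \<or> (\<exists>q. label n s = Hub (n - 1) q)"
        using 6 0 by (cases "(n, s)" rule: label.cases) (auto simp: bound_iff)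
      moreover have "label n x = Core (n - 1)" "n - 1 < n"
        using 6 0 n by auto
      ultimately show thesis
        using nonadj[of s] s that(2) by (auto simp: adj_def underS_def)
    next
      case (Suc k)
      then obtain s where s: "s \<in> X" "(Inl (Inr (0, k)), s) \<in> bound n m" "Inl (Inr (0, k)) \<noteq> s"
          "(s, x) \<in> bound n m" "s \<noteq> x"
        using between[of "Inl (Inr (0, k))"] x(2) 6 by (auto simp: bound_iff Field_bound_iff)
      then have "label n s = Tail k"
        using 6 Suc by (cases "(n, s)" rule: label.cases) (auto simp: bound_iff)
      moreover have "label n x = Core (n - 1 + Suc k)"
        using 6 Suc by simp
      ultimately show thesis
        using nonadj[of s] s n by (simp add: adj_def)
    qed
  next
    case (7 n' l)
    then show thesis
      using that(1) by simp
  qed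
qed

text \<open>
  The limit point is a core \<open>c\<^sub>i\<close> or has fewer than \<open>n - 1\<close> points after it. In the first case one leaf \<open>s\<close> of the
  block below \<open>c\<^sub>i\<close> suffices: every point after \<open>c\<^sub>i\<close> other than a core is joined to \<open>s\<close> or to \<open>c\<^sub>i\<close>.
\<close>

lemma no_independent_closed_copy:
  assumes n: "2 \<le> n" and E: "ramsey_graph n (n + m - 1) E"
    and t: "t \<in> Field (bound n m)" "X \<subseteq> underS (bound n m) t"
    and indep: "\<And>a b. a \<in> X \<Longrightarrow> b \<in> X \<Longrightarrow> a \<noteq> b \<Longrightarrow> \<not> adj n E (label n a) (label n b)"
    and hom: "order_homeomorphic (Restr (bound n m) (underS (bound n m) t)) X (natLeq +\<^sub>O natLeq_on n)"
  shows False
proof -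
  let ?T = "bound n m" and ?U = "underS (bound n m) t"
  have trans: "trans ?T" and antisym: "antisym ?T"
    using Well_order_props[OF Well_order_bound] by blast+
  have W: "Well_order (Restr ?T ?U)"
    by (rule Well_order_Restr[OF Well_order_bound])
  have n0: "0 < n"
    using n by simp
  obtain x Z where x: "x \<in> X" and below: "\<exists>s\<in>X. s \<in> underS (Restr ?T ?U) x"
    and approach: "\<And>y. y \<in> underS (Restr ?T ?U) x \<Longrightarrow>
      \<exists>s\<in>X. s \<in> aboveS (Restr ?T ?U) y \<and> s \<in> underS (Restr ?T ?U) x"
    and Z: "Z \<subseteq> X" "Z \<subseteq> aboveS (Restr ?T ?U) x" "card Z = n - 1"
    by (rule closed_omega_plus_limit_point[OF hom n0 W]) blast
  have U: "a \<in> Field ?T" "(a, t) \<in> ?T" "a \<noteq> t" if "a \<in> X" for a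
    using that t(2) by (auto simp: underS_def intro: FieldI1)
  have finZ: "finite Z"
    using Z(3) n card.infinite by fastforce
  have above: "(x, z) \<in> ?T" "x \<noteq> z" if "z \<in> Z" for z
    using that Z(2) by (auto simp: aboveS_def)
  have below': "\<exists>s\<in>X. s \<in> underS ?T x"
    using below by (auto simp: underS_def)
  have approach': "\<exists>s\<in>X. s \<in> aboveS ?T y \<and> s \<in> underS ?T x" if y: "y \<in> underS ?T x" for y
  proof -
    have "(y, x) \<in> ?T" "(x, t) \<in> ?T" "x \<noteq> t" "y \<noteq> x"
      using y U[OF x] by (auto simp: underS_def)
    then have "y \<in> ?U" "x \<in> ?U"
      using trans antisym by (auto simp: underS_def dest: transD antisymD)
    then show ?thesis
      using approach[of y] y by (auto simp: underS_def aboveS_def)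
  qed
  show False
  proof (rule independent_limit_cases[of n x X m E, OF n0 x U(1)[OF x]])
    show "\<not> adj n E (label n a) (label n b)" if "a \<in> X" "b \<in> X" "a \<noteq> b" for a b
      using that by (rule indep)
    show "\<exists>s\<in>X. s \<in> underS ?T x"
      by (rule below')
    show "\<exists>s\<in>X. s \<in> aboveS ?T y \<and> s \<in> underS ?T x" if "y \<in> underS ?T x" for y
      using that by (rule approach')
  next
    \<comment> \<open>The point \<open>t\<close> that bounds the initial segment is at most the last of the \<open>n\<close> final points.\<close>
    fix l assume l: "x = Inr l"
    have "Z \<subseteq> Inr ` {Suc l..<n - 1}"
    proof
      fix z assume z: "z \<in> Z"
      then have "z \<in> X"
        using Z(1) by blast
      then have "(x, z) \<in> ?T" "x \<noteq> z" "(z, t) \<in> ?T" "z \<noteq> t"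
        using above[OF z] U by blast+
      then show "z \<in> Inr ` {Suc l..<n - 1}"
        using l by (cases z; cases t) (auto simp: bound_iff)
    qed
    then have "card Z \<le> card {Suc l..<n - 1}"
      by (rule surj_card_le[rotated]) simp
    then show False
      using Z(3) n by simp
  next
    fix i q s
    assume i: "i < n" "label n x = Core i" and s: "s \<in> X" "s \<in> underS ?T x" "label n s = Leaf i q"
    have Core: "\<exists>v. label n z = Core v" if z: "z \<in> Z" for z
    proof (rule ccontr)
      assume no: "\<nexists>v. label n z = Core v"
      have "z \<in> X" "z \<noteq> x" "z \<noteq> s"
        using z Z(1) above[OF z] s(2) antisym by (auto simp: underS_def dest: antisymD)
      then have "\<not> adj n E (label n x) (label n z)" "\<not> adj n E (label n s) (label n z)"
        using indep x s(1) by auto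
      then show False
        using no i s(3) label_above_Core[OF above(1)[OF z] i(2,1)]
        by (cases "label n z") (auto simp: adj_def)
    qed
    \<comment> \<open>Distinct points with core labels have distinct labels, so \<open>x\<close> and \<open>Z\<close> yield \<open>n\<close> vertices of \<open>E\<close>.\<close>
    have sub: "insert x Z \<subseteq> X"
      using x Z(1) by blast
    have field: "a \<in> Field ?T" if "a \<in> insert x Z" for a
      using U(1) sub that by blast
    have Core': "\<exists>v. label n a = Core v" if "a \<in> insert x Z" for a
      using that Core i(2) by blast
    have inj: "inj_on (label n) (insert x Z)"
    proof (rule inj_onI)
      fix a b assume ab: "a \<in> insert x Z" "b \<in> insert x Z" "label n a = label n b"
      obtain v where "label n a = Core v"
        using Core'[OF ab(1)] by blast
      then show "a = b"
        using label_eq_Core_inj[OF field[OF ab(1)] field[OF ab(2)]] ab(3) by simp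
    qed
    have "label n ` insert x Z \<subseteq> Core ` {..<n + m - 1}"
    proof (rule image_subsetI)
      fix a assume a: "a \<in> insert x Z"
      obtain v where "label n a = Core v"
        using Core'[OF a] by blast
      then show "label n a \<in> Core ` {..<n + m - 1}"
        using label_eq_Core_less[OF n0 field[OF a]] by blast
    qed
    then obtain S where S: "S \<subseteq> {..<n + m - 1}" "label n ` insert x Z = Core ` S"
      by (meson subset_imageE)
    have "x \<notin> Z"
      using above(2) by blast
    then have "card (Core ` S) = n"
      using card_image[OF inj] S(2) finZ Z(3) n by simp
    then have "card S = n"
      by (simp add: card_image inj_on_def)
    then have "\<exists>u\<in>S. \<exists>v\<in>S. E u v"
      using E S(1) by (simp add: ramsey_graph_def)
    then obtain u v where uv: "u \<in> S" "v \<in> S" "E u v"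
      by blast
    have "u \<noteq> v"
      using ramsey_graph_triangle_free[OF E, of u u u] uv(3) by auto
    have "Core u \<in> label n ` insert x Z" "Core v \<in> label n ` insert x Z"
      unfolding S(2) using uv(1,2) by simp_all
    then obtain a b where a: "Core u = label n a" "a \<in> insert x Z"
        and b: "Core v = label n b" "b \<in> insert x Z"
      by (elim imageE)
    have "adj n E (label n a) (label n b)"
      using uv(3) by (simp add: adj_def flip: a(1) b(1))
    moreover have "a \<noteq> b"
      using \<open>u \<noteq> v\<close> a(1) b(1) by (metis vertex.inject(3))
    moreover have "a \<in> X" "b \<in> X"
      using a(2) b(2) sub by blast+
    ultimately show False
      using indep[of a b] by blast
  qed
qed

lemma not_closed_arrow_below_bound:
  assumes n: "2 \<le> n" and E: "ramsey_graph n (n + m - 1) E"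
    and core: "\<And>u v. u < n - 1 \<Longrightarrow> v < n - 1 \<Longrightarrow> \<not> E u v"
    and t: "t \<in> Field (bound n m)"
  shows "\<not> closed_arrow (Restr (bound n m) (underS (bound n m) t)) (natLeq +\<^sub>O natLeq_on n) (natLeq_on 3)"
proof
  let ?r = "Restr (bound n m) (underS (bound n m) t)"
  assume arrow: "closed_arrow ?r (natLeq +\<^sub>O natLeq_on n) (natLeq_on 3)"
  define c where "c e = (if \<exists>a b. e = {a, b} \<and> adj n E (label n a) (label n b) then 1 else 0::nat)" for e
  have "adj n E y x \<longleftrightarrow> adj n E x y" for x y
    by (auto simp: adj_def)
  then have c: "c {a, b} = (if adj n E (label n a) (label n b) then 1 else 0)" for a b
    unfolding c_def doubleton_eq_iff by metis
  have "c \<in> nsets (Field ?r) 2 \<rightarrow> {0, 1}"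
    by (simp add: c_def)
  then obtain X where X: "X \<subseteq> Field ?r" and
      "(nsets X 2 \<subseteq> c -` {0} \<and> order_homeomorphic ?r X (natLeq +\<^sub>O natLeq_on n)) \<or>
       (nsets X 2 \<subseteq> c -` {1} \<and> order_homeomorphic ?r X (natLeq_on 3))"
    using arrow unfolding closed_arrow_def by meson
  then consider "nsets X 2 \<subseteq> c -` {0}" "order_homeomorphic ?r X (natLeq +\<^sub>O natLeq_on n)"
    | "nsets X 2 \<subseteq> c -` {1}" "order_homeomorphic ?r X (natLeq_on 3)"
    by blast
  then show False
  proof cases
    case 1
    have "\<not> adj n E (label n a) (label n b)" if "a \<in> X" "b \<in> X" "a \<noteq> b" for a b
    proof -
      have "{a, b} \<in> nsets X 2"
        using that by simp
      then have "c {a, b} = 0"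
        using subsetD[OF 1(1)] by simp
      then show ?thesis
        unfolding c by presburger
    qed
    moreover have "X \<subseteq> underS (bound n m) t"
      using X by (auto simp: Field_def)
    ultimately show False
      using no_independent_closed_copy[OF n E t] 1(2) by blast
  next
    case 2
    obtain f where f: "iso (Restr ?r X) (natLeq_on 3) f"
      using 2(2) by (auto simp: order_homeomorphic_def)
    have "Field (Restr ?r X) = X"
      by (rule Refl_Field_Restr2[OF Well_order_props(1)[OF Well_order_Restr[OF Well_order_bound]] X])
    then have "card X = card (Field (natLeq_on 3))"
      using f by (auto simp: iso_iff2 dest: bij_betw_same_card)
    then have "card X = 3"
      by (simp add: Field_natLeq_on)
    then obtain a1 a2 a3 where a: "X = {a1, a2, a3}" "a1 \<noteq> a2" "a1 \<noteq> a3" "a2 \<noteq> a3"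
      unfolding card_3_iff by blast
    have "adj n E (label n a) (label n b)" if "a \<in> X" "b \<in> X" "a \<noteq> b" for a b
    proof -
      have "{a, b} \<in> nsets X 2"
        using that by simp
      then have "c {a, b} = 1"
        using subsetD[OF 2(1)] by simp
      then show ?thesis
        unfolding c by presburger
    qed
    then have "adj n E (label n a1) (label n a2)" "adj n E (label n a2) (label n a3)"
        "adj n E (label n a1) (label n a3)"
      using a by blast+
    moreover have "\<not> (adj n E x y \<and> adj n E y z \<and> adj n E x z)" for x y z
      using E by (rule adj_triangle_free) (rule core)
    ultimately show False
      by blast
  qed
qed

theorem theorem1:
  fixes n :: nat and \<gamma> :: "'a rel"
  assumes "3 \<le> n"
    and "is_closed_ramsey_number \<gamma> (natLeq +\<^sub>O natLeq_on n) (natLeq_on 3)"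
  shows "(natLeq *\<^sub>O natLeq) *\<^sub>O natLeq_on n +\<^sub>O natLeq *\<^sub>O natLeq_on (ramsey_number n 3 - n)
           +\<^sub>O natLeq_on n \<le>o \<gamma>"
proof (rule ccontr)
  let ?m = "ramsey_number n 3 - n"
  let ?T = "bound n ?m"
  assume "\<not> ?T \<le>o \<gamma>"
  moreover have \<gamma>: "Well_order \<gamma>" "closed_arrow \<gamma> (natLeq +\<^sub>O natLeq_on n) (natLeq_on 3)"
    using assms(2) by (auto simp: is_closed_ramsey_number_def)
  ultimately have "\<gamma> <o ?T"
    using Well_order_bound not_ordLeq_iff_ordLess by blast
  then obtain t where t: "t \<in> Field ?T" "\<gamma> =o Restr ?T (underS ?T t)"
    using ordLess_iff_ordIso_Restr[OF Well_order_bound \<gamma>(1)] by blast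
  have arrow: "closed_arrow (Restr ?T (underS ?T t)) (natLeq +\<^sub>O natLeq_on n) (natLeq_on 3)"
    using closed_arrow_ordIso[OF ordIso_symmetric[OF t(2)] \<gamma>(2)] .
  have n: "0 < n" "2 \<le> n"
    using assms(1) by simp_all
  obtain E where E: "ramsey_graph n (ramsey_number n 3 - 1) E"
      and core: "\<And>u v. u < n - 1 \<Longrightarrow> v < n - 1 \<Longrightarrow> \<not> E u v"
    using n(1) by (rule ramsey_graph_with_independent_initial_segment) blast
  have "ramsey_number n 3 - 1 = n + ?m - 1"
    using le_ramsey_number[of 3 n] by simp
  with E have "ramsey_graph n (n + ?m - 1) E"
    by (rule subst[rotated])
  then have "\<not> closed_arrow (Restr ?T (underS ?T t)) (natLeq +\<^sub>O natLeq_on n) (natLeq_on 3)"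
    using core t(1) by (rule not_closed_arrow_below_bound[OF n(2)])
  with arrow show False
    by contradiction
qed

end
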